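(* $n_6(4) \leq 66$; that is, there exists a graph on $66$ vertices with chromatic number $4$ and girth at least $6$.
   Context: All graphs are finite and simple. The girth of a graph is the length of its shortest cycle. For integers $g$ and $k$, $n_g(k)$ denotes the smallest order of a graph with chromatic number exactly $k$ and girth at least $g$. *)

theory Defs
  imports Main "HOL-Library.Extended_Nat"
begin

definition simple_graph :: "'a set \<Rightarrow> 'a set set \<Rightarrow> bool" where
  "simple_graph V E \<longleftrightarrow> finite V \<and> (\<forall>e\<in>E. e \<subseteq> V \<and> card e = 2)"

text \<open>A cycle is given by its vertices in cyclic order, without repeating the first one at the
  end, so that the length of the list is the length of the cycle.\<close>

definition is_cycle :: "'a set \<Rightarrow> 'a set set \<Rightarrow> 'a list \<Rightarrow> bool" where
  "is_cycle V E c \<longleftrightarrow> 3 \<le> length c \<and> distinct c \<and> set c \<subseteq> V \<and>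
     (\<forall>i<length c. {c ! i, c ! (Suc i mod length c)} \<in> E)"

text \<open>The infimum of the empty set is \<open>\<infinity>\<close>, so acyclic graphs have infinite girth.\<close>

definition girth :: "'a set \<Rightarrow> 'a set set \<Rightarrow> enat" where
  "girth V E = Inf {enat (length c) | c. is_cycle V E c}"

definition proper_colouring :: "'a set \<Rightarrow> 'a set set \<Rightarrow> nat \<Rightarrow> ('a \<Rightarrow> nat) \<Rightarrow> bool" where
  "proper_colouring V E k f \<longleftrightarrow>
     (\<forall>v\<in>V. f v < k) \<and> (\<forall>u\<in>V. \<forall>v\<in>V. {u, v} \<in> E \<longrightarrow> f u \<noteq> f v)"

definition chromatic_number :: "'a set \<Rightarrow> 'a set set \<Rightarrow> nat" where
  "chromatic_number V E = (LEAST k. \<exists>f. proper_colouring V E k f)"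

text \<open>Every finite graph is isomorphic to one whose vertices are natural numbers.  The value is
  unspecified if no graph with the required chromatic number and girth exists.\<close>

definition min_order :: "nat \<Rightarrow> nat \<Rightarrow> nat" where
  "min_order g k = (LEAST n. \<exists>(V :: nat set) E. simple_graph V E \<and> card V = n \<and>
     chromatic_number V E = k \<and> enat g \<le> girth V E)"

end

theory Submission
  imports Defs
begin

text \<open>The witness is a 5-regular graph on six rows of eleven vertices, found by a computer search
  among the graphs that are invariant under rotating all rows simultaneously.  A cycle of length
  at most 5 would be a closed non-backtracking walk, and by the symmetry only walks from the
  first vertex of each row have to be examined.  One of the rows is itself an 11-cycle.  As 11 is
  odd, every 3-colouring uses all three colours on some three consecutive vertices of this row,
  without loss of generality on the first three.  This start leaves a propositional problem that
  resolution refutes.\<close>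

section \<open>Girth and chromatic number\<close>

lemma min_order_le_card:
  fixes V :: "nat set"
  assumes "simple_graph V E" "chromatic_number V E = k" "enat g \<le> girth V E"
  shows "min_order g k \<le> card V"
  unfolding min_order_def using assms by (intro Least_le) blast

lemma girth_geI:
  assumes "\<And>c. is_cycle V E c \<Longrightarrow> g \<le> length c"
  shows "enat g \<le> girth V E"
  unfolding girth_def using assms by (auto intro!: Inf_greatest)

lemma proper_colouring_mono:
  assumes "proper_colouring V E k f" "k \<le> l"
  shows "proper_colouring V E l f"
  using assms unfolding proper_colouring_def by force

lemma chromatic_number_eq_SucI:
  assumes "proper_colouring V E (Suc k) f" "\<And>f. \<not> proper_colouring V E k f"
  shows "chromatic_number V E = Suc k"
  unfolding chromatic_number_def
proof (rule Least_equality)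
  show "\<exists>f. proper_colouring V E (Suc k) f"
    using assms(1) by blast
next
  fix l assume "\<exists>f. proper_colouring V E l f"
  then show "Suc k \<le> l"
    using assms(2) proper_colouring_mono not_less_eq_eq by blast
qed

lemma odd_period_three_distinct:
  fixes g :: "nat \<Rightarrow> 'a"
  assumes "odd n" and period: "\<And>i. g (i + n) = g i" and step: "\<And>i. g i \<noteq> g (i + 1)"
  obtains i where "distinct [g i, g (i + 1), g (i + 2)]"
proof -
  have "\<exists>i. g i \<noteq> g (i + 2)"
  proof (rule ccontr)
    assume "\<nexists>i. g i \<noteq> g (i + 2)"
    then have "g (2 * j) = g 0" for j
      by (induction j) auto
    moreover obtain j where "1 + n = 2 * j"
      using \<open>odd n\<close> by (metis evenE odd_even_add odd_one)
    ultimately have "g 1 = g 0"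
      using period[of 1] by simp
    with step[of 0] show False by simp
  qed
  then obtain i where "g i \<noteq> g (i + 2)" ..
  with step[of i] step[of "i + 1"] that[of i] show ?thesis by simp
qed


section \<open>Graphs given by adjacency lists\<close>

definition symmetric_adjacency :: "'a set \<Rightarrow> ('a \<Rightarrow> 'a list) \<Rightarrow> bool" where
  "symmetric_adjacency V N \<longleftrightarrow>
     (\<forall>u\<in>V. \<forall>v\<in>set (N u). v \<in> V \<and> v \<noteq> u \<and> u \<in> set (N v))"

definition adjacency_edges :: "'a set \<Rightarrow> ('a \<Rightarrow> 'a list) \<Rightarrow> 'a set set" where
  "adjacency_edges V N = {{u, v} | u v. u \<in> V \<and> v \<in> set (N u)}"

lemma adjacency_edges_iff:
  assumes "symmetric_adjacency V N"
  shows "{u, v} \<in> adjacency_edges V N \<longleftrightarrow> u \<in> V \<and> v \<in> set (N u)"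
  using assms unfolding adjacency_edges_def symmetric_adjacency_def
  by (auto simp: doubleton_eq_iff)

lemma simple_graph_adjacency_edges:
  assumes "finite V" "symmetric_adjacency V N"
  shows "simple_graph V (adjacency_edges V N)"
proof -
  have "{u, v} \<subseteq> V \<and> card {u, v} = 2" if "u \<in> V" "v \<in> set (N u)" for u v
    using assms(2) that unfolding symmetric_adjacency_def
    by (metis card_2_iff empty_subsetI insert_subset)
  with assms(1) show ?thesis
    unfolding simple_graph_def adjacency_edges_def by blast
qed

lemma proper_colouring_adjacency_iff:
  assumes "symmetric_adjacency V N"
  shows "proper_colouring V (adjacency_edges V N) k f \<longleftrightarrow>
    (\<forall>u\<in>V. f u < k \<and> (\<forall>v\<in>set (N u). f u \<noteq> f v))"
  using assms
  unfolding proper_colouring_def adjacency_edges_iff[OF assms] symmetric_adjacency_def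
  by blast

text \<open>The arc from \<open>u\<close> to \<open>v\<close> can be continued by at most \<open>k\<close> steps, none of which reverses
  the preceding one, to reach \<open>x\<close>.\<close>

fun nonbacktracking_reach :: "('a \<Rightarrow> 'a list) \<Rightarrow> nat \<Rightarrow> 'a \<Rightarrow> 'a \<Rightarrow> 'a \<Rightarrow> bool" where
  "nonbacktracking_reach N 0 u v x \<longleftrightarrow> v = x"
| "nonbacktracking_reach N (Suc k) u v x \<longleftrightarrow>
     v = x \<or> (\<exists>w\<in>set (removeAll u (N v)). nonbacktracking_reach N k v w x)"

lemma is_cycle_nonbacktracking_reach:
  assumes cycle: "is_cycle V E c" and adjacent: "\<And>u v. {u, v} \<in> E \<Longrightarrow> v \<in> set (N u)"
    and "j \<le> k"
  defines "w i \<equiv> c ! (i mod length c)"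
  shows "nonbacktracking_reach N k (w i) (w (Suc i)) (w (Suc (i + j)))"
  using \<open>j \<le> k\<close>
proof (induction k arbitrary: i j)
  case 0
  then show ?case by simp
next
  case (Suc k)
  have len: "3 \<le> length c" and "distinct c"
    using cycle by (auto simp: is_cycle_def)
  have less: "j mod length c < length c" for j
    using len by (intro mod_less_divisor) linarith
  have "w (Suc (Suc i)) \<in> set (N (w (Suc i)))"
    using cycle less[of "Suc i"] unfolding is_cycle_def w_def by (metis adjacent mod_Suc_eq)
  moreover have "w (Suc (Suc i)) \<noteq> w i"
  proof -
    have "Suc (Suc i) mod length c \<noteq> i mod length c"
      using len by (auto simp: mod_Suc)
    with \<open>distinct c\<close> show ?thesis
      by (simp add: w_def nth_eq_iff_index_eq less)
  qed
  ultimately show ?case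
    using Suc.IH[of "j - 1" "Suc i"] Suc.prems by (cases j) auto
qed

lemma girth_adjacency_edges_geI:
  assumes sym: "symmetric_adjacency V N"
    and no_return: "\<And>u v. \<lbrakk>u \<in> V; v \<in> set (N u)\<rbrakk> \<Longrightarrow> \<not> nonbacktracking_reach N k u v u"
  shows "enat (k + 2) \<le> girth V (adjacency_edges V N)"
proof (rule girth_geI)
  fix c assume cycle: "is_cycle V (adjacency_edges V N) c"
  define j where "j = length c - 1"
  have len: "length c = Suc j" "1 < length c"
    using cycle unfolding is_cycle_def j_def by linarith+
  have "{c ! 0, c ! 1} \<in> adjacency_edges V N"
    using cycle len unfolding is_cycle_def by (metis One_nat_def mod_less zero_less_Suc)
  then have "\<not> nonbacktracking_reach N k (c ! 0) (c ! 1) (c ! 0)"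
    by (simp add: adjacency_edges_iff[OF sym] no_return)
  moreover have "nonbacktracking_reach N k (c ! 0) (c ! 1) (c ! 0)" if "j \<le> k"
    using is_cycle_nonbacktracking_reach[OF cycle _ that, of N 0] len
    by (simp add: adjacency_edges_iff[OF sym])
  ultimately have "\<not> j \<le> k" by blast
  with len show "k + 2 \<le> length c" by simp
qed

definition adjacency_embedding :: "('a \<Rightarrow> 'a list) \<Rightarrow> ('a \<Rightarrow> 'a) \<Rightarrow> bool" where
  "adjacency_embedding N \<phi> \<longleftrightarrow> inj \<phi> \<and> (\<forall>x. N (\<phi> x) = map \<phi> (N x))"

lemma nonbacktracking_reach_embedding_iff:
  assumes "adjacency_embedding N \<phi>"
  shows "nonbacktracking_reach N k (\<phi> u) (\<phi> v) (\<phi> x) \<longleftrightarrow> nonbacktracking_reach N k u v x"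
proof (induction k arbitrary: u v)
  case 0
  show ?case using assms by (simp add: adjacency_embedding_def inj_eq)
next
  case (Suc k)
  have "set (removeAll (\<phi> u) (N (\<phi> v))) = \<phi> ` set (removeAll u (N v))"
    using assms by (auto simp: adjacency_embedding_def inj_eq)
  moreover have "\<phi> v = \<phi> x \<longleftrightarrow> v = x"
    using assms by (simp add: adjacency_embedding_def inj_eq)
  ultimately show ?case
    using Suc by (simp del: set_removeAll)
qed

lemma girth_adjacency_edges_orbits_geI:
  assumes sym: "symmetric_adjacency V N"
    and orbits: "\<And>u. u \<in> V \<Longrightarrow> \<exists>r\<in>R. \<exists>\<phi>. adjacency_embedding N \<phi> \<and> \<phi> r = u"
    and no_return: "\<And>r v. \<lbrakk>r \<in> R; v \<in> set (N r)\<rbrakk> \<Longrightarrow> \<not> nonbacktracking_reach N k r v r"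
  shows "enat (k + 2) \<le> girth V (adjacency_edges V N)"
  using sym
proof (rule girth_adjacency_edges_geI)
  fix u v assume "u \<in> V" "v \<in> set (N u)"
  obtain r \<phi> where r: "r \<in> R" "\<phi> r = u" and \<phi>: "adjacency_embedding N \<phi>"
    using orbits[OF \<open>u \<in> V\<close>] by blast
  obtain w where "w \<in> set (N r)" "\<phi> w = v"
    using \<open>v \<in> set (N u)\<close> r \<phi> by (auto simp: adjacency_embedding_def)
  then show "\<not> nonbacktracking_reach N k u v u"
    using nonbacktracking_reach_embedding_iff[OF \<phi>] no_return[OF \<open>r \<in> R\<close>] r by blast
qed

lemma proper_colouring_comp_embedding:
  assumes "symmetric_adjacency V N" "adjacency_embedding N \<phi>" "\<phi> ` V \<subseteq> V"
    and "proper_colouring V (adjacency_edges V N) k f"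
  shows "proper_colouring V (adjacency_edges V N) k (f \<circ> \<phi>)"
  using assms
  by (simp add: proper_colouring_adjacency_iff adjacency_embedding_def image_subset_iff)


section \<open>Polycirculant graphs\<close>

text \<open>Vertex \<open>n * i + x\<close> with \<open>x < n\<close> is the vertex in position \<open>x\<close> of row \<open>i\<close>.  An entry
  \<open>(k, d)\<close> in row \<open>i\<close> of the table \<open>C\<close> joins it to position \<open>x + d\<close>, modulo \<open>n\<close>, of row \<open>k\<close>,
  so a table that describes a graph lists every orbit of edges from both sides.\<close>

definition polycirculant_nbrs :: "nat \<Rightarrow> (nat \<times> nat) list list \<Rightarrow> nat \<Rightarrow> nat list" where
  "polycirculant_nbrs n C u = map (\<lambda>(k, d). n * k + (u + d) mod n) (C ! (u div n))"

definition rotation :: "nat \<Rightarrow> nat \<Rightarrow> nat \<Rightarrow> nat" where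
  "rotation n t v = n * (v div n) + (v + t) mod n"

lemma rotation_div: "rotation n t v div n = v div n"
  by (cases "n = 0") (simp_all add: rotation_def)

lemma rotation_add_mod: "(rotation n t v + s) mod n = (v + t + s) mod n"
  by (simp add: rotation_def mod_simps add.assoc)

lemma rotation_rotation: "rotation n s (rotation n t v) = rotation n (t + s) v"
  unfolding rotation_def[of n s] rotation_div rotation_add_mod
  by (simp add: rotation_def add.assoc)

lemma rotation_mult_self: "rotation n (n * t) v = v"
  by (simp add: rotation_def)

lemma rotation_row_start: "rotation n (u mod n) (n * (u div n)) = u"
  by (cases "n = 0") (simp_all add: rotation_def)

lemma rotation_less:
  assumes "v < n * m"
  shows "rotation n t v < n * m"
proof -
  have "0 < n" using assms by (cases n) simp_all
  with assms show ?thesis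
    by (metis div_less_iff_less_mult mult.commute rotation_div)
qed

lemma inj_rotation:
  assumes "0 < n"
  shows "inj (rotation n t)"
proof (rule inj_on_inverseI)
  fix v
  have "t + (n - 1) * t = n * t"
    using assms by (cases n) simp_all
  then show "rotation n ((n - 1) * t) (rotation n t v) = v"
    by (simp add: rotation_rotation rotation_mult_self)
qed

lemma adjacency_embedding_rotation:
  assumes "0 < n"
  shows "adjacency_embedding (polycirculant_nbrs n C) (rotation n t)"
proof -
  have "n * k + (rotation n t u + d) mod n = rotation n t (n * k + (u + d) mod n)" for k d u
    unfolding rotation_add_mod
    using assms by (simp add: rotation_def mod_simps add.assoc add.commute[of t])
  then show ?thesis
    using inj_rotation[OF assms]
    by (simp add: adjacency_embedding_def polycirculant_nbrs_def rotation_div case_prod_beta)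
qed


section \<open>The graph on 66 vertices\<close>

definition connections66 :: "(nat \<times> nat) list list" where
  "connections66 =
   [[(1, 0), (2, 0), (2, 9), (3, 10), (4, 5)],
    [(0, 0), (1, 1), (1, 10), (2, 3), (3, 7)],
    [(0, 0), (0, 2), (1, 8), (3, 0), (4, 0)],
    [(0, 1), (1, 4), (2, 0), (5, 0), (5, 6)],
    [(0, 6), (2, 0), (4, 1), (4, 10), (5, 3)],
    [(3, 0), (3, 5), (4, 8), (5, 4), (5, 7)]]"

definition nbrs66 :: "nat \<Rightarrow> nat list" where
  "nbrs66 = polycirculant_nbrs 11 connections66"

definition edges66 :: "nat set set" where
  "edges66 = adjacency_edges {..<66} nbrs66"

definition colour66 :: "nat \<Rightarrow> nat" where
  "colour66 v =
   [0, 1, 0, 1, 0, 1, 0, 0, 1, 0, 1,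
    1, 0, 1, 0, 1, 0, 1, 2, 0, 2, 0,
    2, 0, 1, 0, 1, 2, 2, 2, 2, 2, 0,
    0, 2, 0, 1, 2, 1, 1, 0, 1, 0, 1,
    1, 2, 0, 1, 0, 1, 0, 1, 0, 1, 2,
    2, 0, 1, 2, 1, 2, 2, 1, 2, 3, 0] ! v"

lemma symmetric_adjacency_nbrs66: "symmetric_adjacency {..<66} nbrs66"
  unfolding symmetric_adjacency_def lessThan_iff by code_simp

lemma adjacency_embedding_nbrs66: "adjacency_embedding nbrs66 (rotation 11 t)"
  unfolding nbrs66_def by (simp add: adjacency_embedding_rotation)

lemma row_starts_no_return_nbrs66:
  "\<forall>r\<in>{0, 11, 22, 33, 44, 55}. \<forall>v\<in>set (nbrs66 r). \<not> nonbacktracking_reach nbrs66 4 r v r"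
  by code_simp

lemma girth_edges66: "6 \<le> girth {..<66} edges66"
proof -
  let ?R = "{0, 11, 22, 33, 44, 55} :: nat set"
  have "enat (4 + 2) \<le> girth {..<66} (adjacency_edges {..<66} nbrs66)"
    using symmetric_adjacency_nbrs66
  proof (rule girth_adjacency_edges_orbits_geI)
    fix u :: nat assume "u \<in> {..<66}"
    then have "11 * (u div 11) \<in> (*) 11 ` {..<6}"
      by (intro imageI) (simp add: div_less_iff_less_mult)
    also have "(*) 11 ` {..<6} = ?R"
      by code_simp
    finally show "\<exists>r\<in>?R. \<exists>\<phi>. adjacency_embedding nbrs66 \<phi> \<and> \<phi> r = u"
      using adjacency_embedding_nbrs66 rotation_row_start by blast
  next
    show "\<not> nonbacktracking_reach nbrs66 4 r v r" if "r \<in> ?R" "v \<in> set (nbrs66 r)" for r v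
      using that row_starts_no_return_nbrs66 by blast
  qed
  then show ?thesis
    by (simp add: edges66_def numeral_eq_enat)
qed

lemma proper_colouring_edges66_iff:
  "proper_colouring {..<66} edges66 k f \<longleftrightarrow>
    (\<forall>u\<in>{..<66}. f u < k \<and> (\<forall>v\<in>set (nbrs66 u). f u \<noteq> f v))"
  unfolding edges66_def by (rule proper_colouring_adjacency_iff[OF symmetric_adjacency_nbrs66])

lemma proper_colouring_colour66: "proper_colouring {..<66} edges66 4 colour66"
  unfolding proper_colouring_edges66_iff by code_simp

lemma no_three_independent_sets_cover:
  fixes P Q R :: "nat \<Rightarrow> bool"
  assumes start: "P 44" "Q 45" "R 46"
    and cover: "\<forall>v\<in>{..<66}. P v \<or> Q v \<or> R v"
    and independent: "\<forall>u\<in>{..<66}. \<forall>v\<in>set (nbrs66 u).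
      \<not> (P u \<and> P v) \<and> \<not> (Q u \<and> Q v) \<and> \<not> (R u \<and> R v)"
  shows False
proof -
  \<comment> \<open>\<open>upt_rec_numeral\<close> expands intervals only between numerals, and 0 and 1 are not numerals.\<close>
  have vertices: "{..<66} = set (0 # 1 # [2..<66])"
    by code_simp
  from start cover[unfolded vertices, simplified upt_rec_numeral, simplified]
    independent[unfolded vertices nbrs66_def polycirculant_nbrs_def connections66_def,
      simplified upt_rec_numeral, simplified]
  show False by sat
qed

lemma proper_colouring_comp_rotation66:
  assumes "proper_colouring {..<66} edges66 k f"
  shows "proper_colouring {..<66} edges66 k (f \<circ> rotation 11 t)"
proof -
  have "rotation 11 t ` {..<66} \<subseteq> {..<66}"
    using rotation_less[of _ 11 6] by auto
  with assms show ?thesis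
    unfolding edges66_def
    by (intro proper_colouring_comp_embedding symmetric_adjacency_nbrs66 adjacency_embedding_nbrs66)
qed

text \<open>By the entries \<open>(4, 1)\<close> and \<open>(4, 10)\<close> of the table, row 4, the vertices from 44 to 54, is
  an 11-cycle.\<close>

lemma three_distinct_colours_edges66:
  assumes f: "proper_colouring {..<66} edges66 k f"
  obtains t where "distinct [f (rotation 11 t 44), f (rotation 11 t 45), f (rotation 11 t 46)]"
proof -
  define row where "row i = rotation 11 i 44" for i
  have row_add: "row (i + j) = rotation 11 i (row j)" for i j
    by (simp add: row_def rotation_rotation add.commute)
  have row_init: "row 1 = 45" "row 2 = 46"
    by (simp_all add: row_def rotation_def)
  have row_less: "row i \<in> {..<66}" for i
    using rotation_less[of 44 11 6] by (simp add: row_def)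
  have row_adjacent: "row (i + 1) \<in> set (nbrs66 (row i))" for i
  proof -
    have "45 \<in> set (nbrs66 44)"
      by code_simp
    then have "rotation 11 i 45 \<in> set (nbrs66 (rotation 11 i 44))"
      using adjacency_embedding_nbrs66[of i] by (simp add: adjacency_embedding_def)
    then show ?thesis
      by (simp only: row_add[of i 1] row_init row_def[of i])
  qed
  obtain t where t: "distinct [f (row t), f (row (t + 1)), f (row (t + 2))]"
  proof (rule odd_period_three_distinct[of 11 "\<lambda>i. f (row i)"])
    show "f (row (i + 11)) = f (row i)" for i
      using rotation_mult_self[of 11 1] row_add[of 11 i] by (simp add: add.commute)
    show "f (row i) \<noteq> f (row (i + 1))" for i
      using f row_adjacent row_less unfolding proper_colouring_edges66_iff by blast
  qed simp_all
  have "row (t + 1) = rotation 11 t 45" "row (t + 2) = rotation 11 t 46"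
    by (simp_all only: row_add[of t] row_init)
  with t that[of t] show ?thesis by (simp add: row_def)
qed

lemma not_proper_3_colouring_edges66: "\<not> proper_colouring {..<66} edges66 3 f"
proof
  assume f: "proper_colouring {..<66} edges66 3 f"
  obtain t where "distinct [f (rotation 11 t 44), f (rotation 11 t 45), f (rotation 11 t 46)]"
    using f by (rule three_distinct_colours_edges66)
  moreover define h where "h = f \<circ> rotation 11 t"
  ultimately have distinct: "distinct [h 44, h 45, h 46]"
    by simp
  have h: "h u < 3 \<and> (\<forall>v\<in>set (nbrs66 u). h u \<noteq> h v)" if "u \<in> {..<66}" for u
    using proper_colouring_comp_rotation66[OF f, of t] that
    unfolding proper_colouring_edges66_iff h_def by blast
  show False
  proof (rule no_three_independent_sets_cover
      [of "\<lambda>v. h v = h 44" "\<lambda>v. h v = h 45" "\<lambda>v. h v = h 46"])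
    show "\<forall>v\<in>{..<66}. h v = h 44 \<or> h v = h 45 \<or> h v = h 46"
    proof
      fix v :: nat assume "v \<in> {..<66}"
      then have "h v < 3" "h 44 < 3" "h 45 < 3" "h 46 < 3"
        using h by simp_all
      with distinct show "h v = h 44 \<or> h v = h 45 \<or> h v = h 46"
        by simp linarith
    qed
    show "\<forall>u\<in>{..<66}. \<forall>v\<in>set (nbrs66 u). \<not> (h u = h 44 \<and> h v = h 44) \<and>
        \<not> (h u = h 45 \<and> h v = h 45) \<and> \<not> (h u = h 46 \<and> h v = h 46)"
      using h by metis
  qed simp_all
qed

theorem theorem6:
  "min_order 6 4 \<le> 66 \<and>
   (\<exists>(V :: nat set) E. simple_graph V E \<and> card V = 66 \<and>
      chromatic_number V E = 4 \<and> 6 \<le> girth V E)"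
proof -
  have simple: "simple_graph {..<66} edges66"
    unfolding edges66_def
    by (intro simple_graph_adjacency_edges symmetric_adjacency_nbrs66) simp
  have chromatic: "chromatic_number {..<66} edges66 = 4"
    using chromatic_number_eq_SucI[of "{..<66}" edges66 3 colour66]
      proper_colouring_colour66 not_proper_3_colouring_edges66 by simp
  have "min_order 6 4 \<le> card {..<66 :: nat}"
    using simple chromatic girth_edges66
    by (intro min_order_le_card) (simp_all add: numeral_eq_enat)
  moreover have "card {..<66 :: nat} = 66" by simp
  ultimately show ?thesis
    using simple chromatic girth_edges66 by metis
qed

end
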